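(* Let $(\varphi_n)_{n\in\mathbb N}$ be a sequence of formulas of the logic $\mathcal R\text{Ł}$ and let $\varphi$ be a formula of $\mathcal R\text{Ł}$. Then the following are equivalent: (i) the sequence of term functions $(f_{\varphi_n})_n$ converges uniformly to $f_\varphi$; (ii) for every $r\in[0,1)$ there exists $k$ such that $\vdash \eta_r\rightarrow(\varphi\leftrightarrow\varphi_n)$ for every $n\ge k$; (iii) there is a decreasing sequence $([\psi_n])_n$ in the Lindenbaum–Tarski algebra $RL$ of $\mathcal R\text{Ł}$ such that $\bigwedge_n[\psi_n]=0$ pointwise (i.e. $\inf_n f_{\psi_n}(\mathbf x)=0$ for every point $\mathbf x$) and $d([\varphi_n],[\varphi])\le[\psi_n]$ for every $n$; (iv) there exists an increasing sequence $(r_n)_n$ in $[0,1]$ such that $\bigvee_n r_n=1$ and $\vdash\eta_{r_n}\rightarrow(\varphi\leftrightarrow\varphi_n)$ for every $n$.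
   Context: The logic $\mathcal R\text{Ł}$: formulas are built from propositional variables $v_1,v_2,\dots$ with connectives $\neg$, $\rightarrow$ and unary connectives $\nabla_r$, $r\in[0,1]$. Abbreviations: $\varphi\vee\psi=(\varphi\to\psi)\to\psi$, $\varphi\&\psi=\neg(\varphi\to\neg\psi)$, $\varphi\leftrightarrow\psi=(\varphi\to\psi)\&(\psi\to\varphi)$, $\Delta_r\varphi=\neg\nabla_r\neg\varphi$. For reals $r,q\in[0,1]$, $r\odot q^*=\max(0,r-q)$. Axioms: (L1) $\varphi\to(\psi\to\varphi)$; (L2) $(\varphi\to\psi)\to((\psi\to\chi)\to(\varphi\to\chi))$; (L3) $(\varphi\vee\psi)\to(\psi\vee\varphi)$; (L4) $(\neg\psi\to\neg\varphi)\to(\varphi\to\psi)$; (R1) $\nabla_r(\varphi\to\psi)\leftrightarrow(\nabla_r\varphi\to\nabla_r\psi)$; (R2) $\nabla_{r\odot q^*}\varphi\leftrightarrow(\nabla_q\varphi\to\nabla_r\varphi)$; (R3) $\nabla_r(\nabla_q\varphi)\leftrightarrow\nabla_{rq}\varphi$; (R4) $\nabla_1\varphi\leftrightarrow\varphi$. The only rule is modus ponens; $\vdash\varphi$ means $\varphi$ is derivable from the axioms. A $[0,1]$-evaluation is a map $e$ from formulas to $[0,1]$ with $e(\neg\varphi)=1-e(\varphi)$, $e(\varphi\to\psi)=\min(1,1-e(\varphi)+e(\psi))$, $e(\nabla_r\varphi)=1-r(1-e(\varphi))$ (so $e(\Delta_r\varphi)=r\,e(\varphi)$). The term function $f_\varphi$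 maps a point $\mathbf x$ (a $[0,1]$-valued assignment to the variables) to the value of $\varphi$ under the evaluation extending $\mathbf x$; all term functions are regarded as functions on the common domain $[0,1]^{V}$, $V$ the set of variables (each depends only on the finitely many variables occurring in the formula). $\eta$ is a fixed theorem of $\mathcal R\text{Ł}$ and $\eta_r:=\Delta_r\eta$ for $r\in[0,1]$. The Lindenbaum–Tarski algebra $RL$ is the set of classes $[\varphi]$ of formulas modulo $\vdash\varphi\leftrightarrow\psi$, ordered by $[\alpha]\le[\beta]$ iff $\vdash\alpha\to\beta$; $d([\alpha],[\beta])=[\neg(\alpha\leftrightarrow\beta)]$ is Chang's distance, whose term function is $|f_\alpha-f_\beta|$. *)

theory Defs
  imports "HOL-Analysis.Analysis"
begin

typedef unit_interval = "{0..1::real}"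
  morphisms real_of_ui ui_of_real
  by (rule exI[of _ 0]) simp

setup_lifting type_definition_unit_interval

instantiation unit_interval :: "{linorder, one, times}"
begin
lift_definition less_eq_unit_interval :: "unit_interval \<Rightarrow> unit_interval \<Rightarrow> bool" is "(\<le>)" .
lift_definition less_unit_interval :: "unit_interval \<Rightarrow> unit_interval \<Rightarrow> bool" is "(<)" .
lift_definition one_unit_interval :: unit_interval is 1 by simp
lift_definition times_unit_interval :: "unit_interval \<Rightarrow> unit_interval \<Rightarrow> unit_interval" is "(*)"
  by (simp add: mult_le_one)
instance
  by standard (transfer; auto)+
end

text \<open>Truncated subtraction, written \<open>r \<odot> q\<^sup>*\<close> in MV-algebra notation.\<close>

lift_definition trunc_diff :: "unit_interval \<Rightarrow> unit_interval \<Rightarrow> unit_interval"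
  is "\<lambda>r q. max 0 (r - q)"
  by auto


section \<open>Formulas and derivability\<close>

datatype form =
    Var nat
  | Neg form  ("\<^bold>\<not> _" [80] 80)
  | Imp form form  (infixr "\<^bold>\<rightarrow>" 55)
  | Nabla unit_interval form

definition Or :: "form \<Rightarrow> form \<Rightarrow> form" (infixr "\<^bold>\<or>" 60)
  where "a \<^bold>\<or> b = ((a \<^bold>\<rightarrow> b) \<^bold>\<rightarrow> b)"

definition Conj :: "form \<Rightarrow> form \<Rightarrow> form" (infixr "\<^bold>&" 65)
  where "a \<^bold>& b = \<^bold>\<not> (a \<^bold>\<rightarrow> \<^bold>\<not> b)"

definition Iff :: "form \<Rightarrow> form \<Rightarrow> form" (infix "\<^bold>\<leftrightarrow>" 54)
  where "(a \<^bold>\<leftrightarrow> b) = ((a \<^bold>\<rightarrow> b) \<^bold>& (b \<^bold>\<rightarrow> a))"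

definition Delta :: "unit_interval \<Rightarrow> form \<Rightarrow> form"
  where "Delta r a = \<^bold>\<not> Nabla r (\<^bold>\<not> a)"

inductive derivable :: "form \<Rightarrow> bool" ("\<turnstile> _" [50] 50) where
  L1: "\<turnstile> a \<^bold>\<rightarrow> (b \<^bold>\<rightarrow> a)"
| L2: "\<turnstile> (a \<^bold>\<rightarrow> b) \<^bold>\<rightarrow> ((b \<^bold>\<rightarrow> c) \<^bold>\<rightarrow> (a \<^bold>\<rightarrow> c))"
| L3: "\<turnstile> (a \<^bold>\<or> b) \<^bold>\<rightarrow> (b \<^bold>\<or> a)"
| L4: "\<turnstile> (\<^bold>\<not> b \<^bold>\<rightarrow> \<^bold>\<not> a) \<^bold>\<rightarrow> (a \<^bold>\<rightarrow> b)"
| R1: "\<turnstile> Nabla r (a \<^bold>\<rightarrow> b) \<^bold>\<leftrightarrow> (Nabla r a \<^bold>\<rightarrow> Nabla r b)"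
| R2: "\<turnstile> Nabla (trunc_diff r q) a \<^bold>\<leftrightarrow> (Nabla q a \<^bold>\<rightarrow> Nabla r a)"
| R3: "\<turnstile> Nabla r (Nabla q a) \<^bold>\<leftrightarrow> Nabla (r * q) a"
| R4: "\<turnstile> Nabla 1 a \<^bold>\<leftrightarrow> a"
| MP: "\<turnstile> a \<Longrightarrow> \<turnstile> a \<^bold>\<rightarrow> b \<Longrightarrow> \<turnstile> b"


section \<open>Term functions\<close>

definition evaluation :: "(form \<Rightarrow> real) \<Rightarrow> bool"
  where "evaluation e \<longleftrightarrow>
    range e \<subseteq> {0..1} \<and>
    (\<forall>a. e (\<^bold>\<not> a) = 1 - e a) \<and>
    (\<forall>a b. e (a \<^bold>\<rightarrow> b) = min 1 (1 - e a + e b)) \<and>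
    (\<forall>r a. e (Nabla r a) = 1 - real_of_ui r * (1 - e a))"

definition points :: "(nat \<Rightarrow> real) set"
  where "points = UNIV \<rightarrow> {0..1}"

primrec term_fun :: "form \<Rightarrow> (nat \<Rightarrow> real) \<Rightarrow> real" where
  "term_fun (Var i) x = x i"
| "term_fun (\<^bold>\<not> a) x = 1 - term_fun a x"
| "term_fun (a \<^bold>\<rightarrow> b) x = min 1 (1 - term_fun a x + term_fun b x)"
| "term_fun (Nabla r a) x = 1 - real_of_ui r * (1 - term_fun a x)"

text \<open>On \<open>points\<close>, \<open>term_fun\<close> gives the value under the unique evaluation extending the point.\<close>

lemma term_fun_bounds:
  assumes "x \<in> points"
  shows "term_fun a x \<in> {0..1}"
proof (induction a)
  case (Nabla r a)
  have "real_of_ui r \<in> {0..1}" by (rule real_of_ui)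
  then have "0 \<le> real_of_ui r * (1 - term_fun a x)" "real_of_ui r * (1 - term_fun a x) \<le> 1"
    using Nabla by (auto intro: mult_le_one)
  then show ?case by simp
qed (use assms in \<open>auto simp: points_def Pi_iff\<close>)

lemma evaluation_term_fun: "x \<in> points \<Longrightarrow> evaluation (\<lambda>a. term_fun a x)"
  using term_fun_bounds by (auto simp: evaluation_def)

lemma evaluation_unique:
  assumes "evaluation e" "\<And>i. e (Var i) = x i"
  shows "e a = term_fun a x"
  using assms by (induction a) (auto simp: evaluation_def)


section \<open>The Lindenbaum--Tarski algebra\<close>

lemma imp_trans: "\<turnstile> a \<^bold>\<rightarrow> b \<Longrightarrow> \<turnstile> b \<^bold>\<rightarrow> c \<Longrightarrow> \<turnstile> a \<^bold>\<rightarrow> c"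
  by (meson L2 MP)

lemma assertion: "\<turnstile> a \<^bold>\<rightarrow> ((a \<^bold>\<rightarrow> b) \<^bold>\<rightarrow> b)"
  using imp_trans[OF L1 L3[unfolded Or_def]] .

lemma imp_exchange: "\<turnstile> a \<^bold>\<rightarrow> (b \<^bold>\<rightarrow> c) \<Longrightarrow> \<turnstile> b \<^bold>\<rightarrow> (a \<^bold>\<rightarrow> c)"
  by (meson L2 MP assertion imp_trans)

lemma imp_refl: "\<turnstile> a \<^bold>\<rightarrow> a"
  by (meson L1 MP imp_exchange)

lemma dn_elim: "\<turnstile> \<^bold>\<not> \<^bold>\<not> a \<^bold>\<rightarrow> a"
proof -
  have "\<turnstile> \<^bold>\<not> \<^bold>\<not> a \<^bold>\<rightarrow> ((a \<^bold>\<rightarrow> a) \<^bold>\<rightarrow> a)"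
    using L1[of "\<^bold>\<not> \<^bold>\<not> a" "\<^bold>\<not> \<^bold>\<not> (a \<^bold>\<rightarrow> a)"] L4 by (meson imp_trans)
  then show ?thesis
    by (meson MP imp_exchange imp_refl)
qed

lemma dn_intro: "\<turnstile> a \<^bold>\<rightarrow> \<^bold>\<not> \<^bold>\<not> a"
  by (rule MP[OF dn_elim L4])

lemma contrapos: "\<turnstile> a \<^bold>\<rightarrow> b \<Longrightarrow> \<turnstile> \<^bold>\<not> b \<^bold>\<rightarrow> \<^bold>\<not> a"
  by (meson L4 MP dn_elim dn_intro imp_trans)

lemma conj_intro: "\<turnstile> a \<Longrightarrow> \<turnstile> b \<Longrightarrow> \<turnstile> a \<^bold>& b"
  unfolding Conj_def by (meson MP assertion contrapos dn_intro)

lemma conj_elim1: "\<turnstile> a \<^bold>& b \<^bold>\<rightarrow> a"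
  unfolding Conj_def
  by (rule imp_trans[OF contrapos[OF imp_trans[OF L1 L4]] dn_elim])

lemma conj_elim2: "\<turnstile> a \<^bold>& b \<^bold>\<rightarrow> b"
  unfolding Conj_def by (rule imp_trans[OF contrapos[OF L1] dn_elim])

lemma derivable_iff: "\<turnstile> a \<^bold>\<leftrightarrow> b \<longleftrightarrow> \<turnstile> a \<^bold>\<rightarrow> b \<and> \<turnstile> b \<^bold>\<rightarrow> a"
  unfolding Iff_def by (meson MP conj_intro conj_elim1 conj_elim2)

lemma imp_mono: "\<turnstile> a' \<^bold>\<rightarrow> a \<Longrightarrow> \<turnstile> b \<^bold>\<rightarrow> b' \<Longrightarrow> \<turnstile> (a \<^bold>\<rightarrow> b) \<^bold>\<rightarrow> (a' \<^bold>\<rightarrow> b')"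
  by (meson L2 MP imp_exchange imp_trans)

lemma conj_mono: "\<turnstile> a \<^bold>\<rightarrow> a' \<Longrightarrow> \<turnstile> b \<^bold>\<rightarrow> b' \<Longrightarrow> \<turnstile> (a \<^bold>& b) \<^bold>\<rightarrow> (a' \<^bold>& b')"
  unfolding Conj_def by (intro contrapos imp_mono)

lemma iff_mono:
  assumes "\<turnstile> a \<^bold>\<leftrightarrow> a'" "\<turnstile> b \<^bold>\<leftrightarrow> b'"
  shows "\<turnstile> (a \<^bold>\<leftrightarrow> b) \<^bold>\<rightarrow> (a' \<^bold>\<leftrightarrow> b')"
  using assms unfolding derivable_iff unfolding Iff_def by (intro conj_mono imp_mono) auto

quotient_type RL = form / "\<lambda>a b. \<turnstile> a \<^bold>\<leftrightarrow> b"
  morphisms rep_RL RL_class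
  by (auto intro!: equivpI reflpI sympI transpI simp: derivable_iff intro: imp_refl imp_trans)

instantiation RL :: order
begin
lift_definition less_eq_RL :: "RL \<Rightarrow> RL \<Rightarrow> bool" is "\<lambda>a b. \<turnstile> a \<^bold>\<rightarrow> b"
  unfolding derivable_iff by (meson imp_trans)
definition less_RL :: "RL \<Rightarrow> RL \<Rightarrow> bool"
  where "less_RL A B \<longleftrightarrow> A \<le> B \<and> \<not> B \<le> A"
instance
proof
  fix A B C :: RL
  show "A < B \<longleftrightarrow> A \<le> B \<and> \<not> B \<le> A" by (rule less_RL_def)
  show "A \<le> A" by transfer (rule imp_refl)
  show "A \<le> B \<Longrightarrow> B \<le> C \<Longrightarrow> A \<le> C" by transfer (rule imp_trans)
  show "A \<le> B \<Longrightarrow> B \<le> A \<Longrightarrow> A = B" by transfer (simp add: derivable_iff)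
qed
end

lift_definition chang_dist :: "RL \<Rightarrow> RL \<Rightarrow> RL" is "\<lambda>a b. \<^bold>\<not> (a \<^bold>\<leftrightarrow> b)"
  by (meson contrapos derivable_iff iff_mono)

end

theory Submission
  imports Defs
begin

text \<open>The implications run in the cycle (i), (ii), (iv), (iii), (i). Only (i) to (ii) needs
  completeness, and since \<open>r < 1\<close> leaves some slack, a Pavelka-style approximate completeness
  suffices: a formula whose values all exceed some \<open>c > r\<close> follows from \<open>\<eta>\<^sub>r\<close>. If it did not, a maximal
  theory \<open>T\<close> avoiding this implication would be linear, and sending each formula to the supremum of
  the constants that imply it modulo \<open>T\<close> would be an evaluation violating the bound.
  In (iii) the \<open>\<psi>\<^sub>n\<close> may be chosen constant, and the way back is Dini's argument on the compact cube.\<close>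

section \<open>Joins and prelinearity in the implicational fragment\<close>

text \<open>Disjunction is (a \<rightarrow> b) \<rightarrow> b, so its symmetry comes from (L3):
  replace a by c, swap, and the disjunction of b and c collapses to c because b \<rightarrow> c is a
  theorem.\<close>

lemma or_lub:
  assumes "\<turnstile> a \<^bold>\<rightarrow> c" "\<turnstile> b \<^bold>\<rightarrow> c"
  shows "\<turnstile> (a \<^bold>\<or> b) \<^bold>\<rightarrow> c"
proof -
  have "\<turnstile> (a \<^bold>\<or> b) \<^bold>\<rightarrow> (c \<^bold>\<or> b)"
    unfolding Or_def using assms(1) by (intro imp_mono imp_refl)
  moreover have "\<turnstile> (b \<^bold>\<or> c) \<^bold>\<rightarrow> c"
    unfolding Or_def using assms(2) assertion MP by blast
  ultimately show ?thesis
    using L3 imp_trans by blast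
qed

lemma or_left: "\<turnstile> a \<^bold>\<rightarrow> (a \<^bold>\<or> b)"
  unfolding Or_def by (rule assertion)

lemma or_right: "\<turnstile> b \<^bold>\<rightarrow> (a \<^bold>\<or> b)"
  unfolding Or_def by (rule L1)

lemma contrapos_imp: "\<turnstile> (a \<^bold>\<rightarrow> b) \<^bold>\<rightarrow> (\<^bold>\<not> b \<^bold>\<rightarrow> \<^bold>\<not> a)"
  using imp_trans[OF imp_mono[OF dn_elim dn_intro] L4] .

lemma imp_swap: "\<turnstile> (a \<^bold>\<rightarrow> (b \<^bold>\<rightarrow> c)) \<^bold>\<rightarrow> (b \<^bold>\<rightarrow> (a \<^bold>\<rightarrow> c))"
proof -
  have "\<turnstile> (a \<^bold>\<rightarrow> (b \<^bold>\<rightarrow> c)) \<^bold>\<rightarrow> (((b \<^bold>\<rightarrow> c) \<^bold>\<rightarrow> c) \<^bold>\<rightarrow> (a \<^bold>\<rightarrow> c))"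
    by (rule L2)
  then show ?thesis
    by (rule imp_trans) (rule imp_mono[OF assertion imp_refl])
qed

lemma conj_commute: "\<turnstile> (a \<^bold>& b) \<^bold>\<rightarrow> (b \<^bold>& a)"
  unfolding Conj_def
  by (rule contrapos[OF imp_trans[OF contrapos_imp imp_mono[OF dn_intro imp_refl]]])

text \<open>Divisibility: if \<open>a \<le> x\<close> then \<open>a\<close> is \<open>x & (x \<rightarrow> a)\<close>, so the common antecedent \<open>x\<close> may be
  replaced by \<open>a\<close>.\<close>

lemma imp_cancel:
  assumes "\<turnstile> a \<^bold>\<rightarrow> x"
  shows "\<turnstile> ((x \<^bold>\<rightarrow> a) \<^bold>\<rightarrow> (x \<^bold>\<rightarrow> b)) \<^bold>\<rightarrow> (a \<^bold>\<rightarrow> b)"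
proof -
  let ?na = "\<^bold>\<not> a" and ?nb = "\<^bold>\<not> b" and ?nx = "\<^bold>\<not> x"
  have 1: "\<turnstile> ((x \<^bold>\<rightarrow> a) \<^bold>\<rightarrow> (x \<^bold>\<rightarrow> b)) \<^bold>\<rightarrow> ((?na \<^bold>\<rightarrow> ?nx) \<^bold>\<rightarrow> (?nb \<^bold>\<rightarrow> ?nx))"
    by (intro imp_mono L4 contrapos_imp)
  have 2: "\<turnstile> ((?na \<^bold>\<rightarrow> ?nx) \<^bold>\<rightarrow> (?nb \<^bold>\<rightarrow> ?nx)) \<^bold>\<rightarrow> (?nb \<^bold>\<rightarrow> (?na \<^bold>\<or> ?nx))"
    unfolding Or_def by (rule imp_swap)
  have "\<turnstile> ?nx \<^bold>\<rightarrow> ?na"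
    using assms by (rule contrapos)
  then have "\<turnstile> (?na \<^bold>\<or> ?nx) \<^bold>\<rightarrow> ?na"
    by (intro or_lub imp_refl)
  then have 3: "\<turnstile> (?nb \<^bold>\<rightarrow> (?na \<^bold>\<or> ?nx)) \<^bold>\<rightarrow> (?nb \<^bold>\<rightarrow> ?na)"
    by (intro imp_mono imp_refl)
  show ?thesis
    using 1 2 3 L4 imp_trans by meson
qed

text \<open>Let x be the disjunction of a and b. As x \<rightarrow> b gives a \<rightarrow> b, and b
  \<rightarrow> a gives x \<rightarrow> a, the formula (a \<rightarrow> b) \<rightarrow> (b
  \<rightarrow> a) yields (x \<rightarrow> b) \<rightarrow> (x \<rightarrow> a), which
  \<open>imp_cancel\<close> reduces to b \<rightarrow> a. Unfolded, this is the claim.\<close>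

lemma prelinearity: "\<turnstile> (a \<^bold>\<rightarrow> b) \<^bold>\<or> (b \<^bold>\<rightarrow> a)"
proof -
  let ?x = "a \<^bold>\<or> b"
  have 1: "\<turnstile> (?x \<^bold>\<rightarrow> b) \<^bold>\<rightarrow> (a \<^bold>\<rightarrow> b)"
    by (intro imp_mono or_left imp_refl)
  have "\<turnstile> (b \<^bold>\<rightarrow> a) \<^bold>\<rightarrow> ((b \<^bold>\<or> a) \<^bold>\<rightarrow> a)"
    unfolding Or_def by (rule assertion)
  then have 2: "\<turnstile> (b \<^bold>\<rightarrow> a) \<^bold>\<rightarrow> (?x \<^bold>\<rightarrow> a)"
    by (rule imp_trans) (intro imp_mono L3 imp_refl)
  have "\<turnstile> ((a \<^bold>\<rightarrow> b) \<^bold>\<rightarrow> (b \<^bold>\<rightarrow> a)) \<^bold>\<rightarrow> ((?x \<^bold>\<rightarrow> b) \<^bold>\<rightarrow> (?x \<^bold>\<rightarrow> a))"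
    using 1 2 by (rule imp_mono)
  then have "\<turnstile> ((a \<^bold>\<rightarrow> b) \<^bold>\<rightarrow> (b \<^bold>\<rightarrow> a)) \<^bold>\<rightarrow> (b \<^bold>\<rightarrow> a)"
    by (rule imp_trans) (intro imp_cancel or_right)
  then show ?thesis
    by (simp add: Or_def)
qed

text \<open>Modus ponens with a side disjunct c carried along, the inductive step of
  \<open>or_consequences\<close>.\<close>

lemma or_mp: "\<turnstile> (a \<^bold>\<or> c) \<^bold>\<rightarrow> (((a \<^bold>\<rightarrow> b) \<^bold>\<or> c) \<^bold>\<rightarrow> (b \<^bold>\<or> c))"
proof (rule or_lub)
  have "\<turnstile> ((a \<^bold>\<rightarrow> b) \<^bold>\<or> c) \<^bold>\<rightarrow> (a \<^bold>\<rightarrow> (b \<^bold>\<or> c))"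
    by (intro or_lub imp_mono imp_refl or_left imp_trans[OF or_right L1])
  then show "\<turnstile> a \<^bold>\<rightarrow> (((a \<^bold>\<rightarrow> b) \<^bold>\<or> c) \<^bold>\<rightarrow> (b \<^bold>\<or> c))"
    by (rule imp_exchange)
  show "\<turnstile> c \<^bold>\<rightarrow> (((a \<^bold>\<rightarrow> b) \<^bold>\<or> c) \<^bold>\<rightarrow> (b \<^bold>\<or> c))"
    by (intro imp_trans[OF or_right L1])
qed


section \<open>Linear theories\<close>

inductive_set consequences :: "form set \<Rightarrow> form set" for A where
  conseq_hyp: "a \<in> A \<Longrightarrow> a \<in> consequences A"
| conseq_thm: "\<turnstile> a \<Longrightarrow> a \<in> consequences A"
| conseq_MP: "a \<in> consequences A \<Longrightarrow> a \<^bold>\<rightarrow> b \<in> consequences A \<Longrightarrow> b \<in> consequences A"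

definition deductive :: "form set \<Rightarrow> bool"
  where "deductive T \<longleftrightarrow> (\<forall>a. \<turnstile> a \<longrightarrow> a \<in> T) \<and> (\<forall>a b. a \<in> T \<longrightarrow> a \<^bold>\<rightarrow> b \<in> T \<longrightarrow> b \<in> T)"

lemma deductiveD:
  assumes "deductive T"
  shows "\<turnstile> a \<Longrightarrow> a \<in> T" "a \<in> T \<Longrightarrow> a \<^bold>\<rightarrow> b \<in> T \<Longrightarrow> b \<in> T"
  using assms unfolding deductive_def by blast+

lemma deductive_consequences: "deductive (consequences A)"
  unfolding deductive_def by (blast intro: conseq_thm conseq_MP)

text \<open>Without contraction the classical deduction theorem fails, but proof by cases survives:
  the disjunct c is attached to every formula of a derivation from a.\<close>

lemma or_consequences:
  assumes T: "deductive T" and "b \<in> consequences (insert a T)" and ac: "a \<^bold>\<or> c \<in> T"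
  shows "b \<^bold>\<or> c \<in> T"
  using assms(2)
proof induction
  case (conseq_hyp a')
  then show ?case
    using ac deductiveD[OF T] or_left by blast
next
  case (conseq_thm a')
  then show ?case
    using MP deductiveD(1)[OF T] or_left by blast
next
  case (conseq_MP a' b')
  then show ?case
    using deductiveD[OF T] or_mp by blast
qed

lemma linear_extension:
  assumes "\<not> \<turnstile> c"
  shows "\<exists>T. deductive T \<and> c \<notin> T \<and> (\<forall>a b. a \<^bold>\<rightarrow> b \<in> T \<or> b \<^bold>\<rightarrow> a \<in> T)"
proof -
  let ?A = "{T. deductive T \<and> c \<notin> T}"
  have "\<exists>M\<in>?A. \<forall>X\<in>?A. M \<subseteq> X \<longrightarrow> X = M"
  proof (rule subset_Zorn_nonempty)
    have "{a. \<turnstile> a} \<in> ?A"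
      unfolding deductive_def using assms MP by blast
    then show "?A \<noteq> {}" by blast
    fix C assume C: "C \<noteq> {}" "subset.chain ?A C"
    have sub: "C \<subseteq> ?A" and lin: "\<And>X Y. X \<in> C \<Longrightarrow> Y \<in> C \<Longrightarrow> X \<subseteq> Y \<or> Y \<subseteq> X"
      using C(2) by (auto simp: subset_chain_def)
    have "deductive (\<Union>C)"
      unfolding deductive_def
    proof (intro conjI allI impI)
      fix a assume "\<turnstile> a"
      then show "a \<in> \<Union>C"
        using C(1) sub by (auto dest: deductiveD(1))
    next
      fix a b assume "a \<in> \<Union>C" "a \<^bold>\<rightarrow> b \<in> \<Union>C"
      then obtain X Y where XY: "X \<in> C" "Y \<in> C" "a \<in> X" "a \<^bold>\<rightarrow> b \<in> Y" by blast
      then obtain Z where "Z \<in> C" "a \<in> Z" "a \<^bold>\<rightarrow> b \<in> Z"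
        using lin[OF XY(1,2)] by blast
      moreover from \<open>Z \<in> C\<close> sub have "deductive Z" by blast
      ultimately show "b \<in> \<Union>C"
        using deductiveD(2) by blast
    qed
    then show "\<Union>C \<in> ?A" using sub by blast
  qed
  then obtain T where T: "deductive T" "c \<notin> T"
    and max: "\<And>X. deductive X \<Longrightarrow> c \<notin> X \<Longrightarrow> T \<subseteq> X \<Longrightarrow> X = T"
    by blast
  have ext: "c \<in> consequences (insert a T)" if "a \<notin> T" for a
    using max[OF deductive_consequences, of "insert a T"] that by (auto intro: conseq_hyp)
  have "a \<^bold>\<rightarrow> b \<in> T \<or> b \<^bold>\<rightarrow> a \<in> T" for a b
  proof (rule ccontr)
    assume "\<not> ?thesis"
    then have ab: "c \<in> consequences (insert (a \<^bold>\<rightarrow> b) T)"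
      and ba: "c \<in> consequences (insert (b \<^bold>\<rightarrow> a) T)"
      using ext by blast+
    \<comment> \<open>Cases on prelinearity: c follows from T in each branch, so the two disjuncts
      are replaced by c one after the other.\<close>
    have "c \<^bold>\<or> (b \<^bold>\<rightarrow> a) \<in> T"
      by (rule or_consequences[OF T(1) ab]) (intro deductiveD(1)[OF T(1)] prelinearity)
    then have "(b \<^bold>\<rightarrow> a) \<^bold>\<or> c \<in> T"
      using deductiveD[OF T(1)] L3 by blast
    then have "c \<^bold>\<or> c \<in> T"
      by (rule or_consequences[OF T(1) ba])
    moreover have "\<turnstile> (c \<^bold>\<or> c) \<^bold>\<rightarrow> c"
      by (intro or_lub imp_refl)
    ultimately show False
      using deductiveD[OF T(1)] T(2) by blast
  qed
  with T show ?thesis by blast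
qed


section \<open>The truth value of a formula modulo a linear theory\<close>

lemma real_of_ui_ge_0: "0 \<le> real_of_ui r" and real_of_ui_le_1: "real_of_ui r \<le> 1"
  using real_of_ui[of r] by auto

text \<open>Degree 0 is r truncated-minus r, so (R2) identifies the formula with an implication from
  a formula to itself.\<close>

lemma Nabla_0:
  assumes "real_of_ui r = 0"
  shows "\<turnstile> Nabla r a"
proof -
  have "r = trunc_diff r r"
    using assms by (simp add: trunc_diff.rep_eq flip: real_of_ui_inject)
  then show ?thesis
    using R2[of r r a] by (metis MP derivable_iff imp_refl)
qed

lemma Nabla_antimono:
  assumes "real_of_ui r \<le> real_of_ui q"
  shows "\<turnstile> Nabla q a \<^bold>\<rightarrow> Nabla r a"
proof -
  have "\<turnstile> Nabla (trunc_diff r q) a"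
    using assms by (intro Nabla_0) (simp add: trunc_diff.rep_eq)
  then show ?thesis
    using R2 derivable_iff MP by blast
qed

lemma ex_falso:
  assumes "\<turnstile> \<eta>"
  shows "\<turnstile> \<^bold>\<not> \<eta> \<^bold>\<rightarrow> a"
  using assms by (meson L1 L4 MP dn_intro imp_trans contrapos)

text \<open>As \<eta> is a theorem, its negation is a falsum and \<open>proper\<close> is
  consistency. The constants are built from this falsum.\<close>

locale linear_theory =
  fixes T :: "form set" and \<eta> :: form
  assumes ded: "deductive T"
    and linear: "\<And>a b. a \<^bold>\<rightarrow> b \<in> T \<or> b \<^bold>\<rightarrow> a \<in> T"
    and proper: "\<^bold>\<not> \<eta> \<notin> T"
    and \<eta>: "\<turnstile> \<eta>"
begin

text \<open>\<open>K s\<close> is the constant \<open>1 - s\<close>, so \<open>falsity a\<close> is one minus the truth value of \<open>a\<close> modulo \<open>T\<close>.\<close>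

abbreviation K :: "unit_interval \<Rightarrow> form"
  where "K s \<equiv> Nabla s (\<^bold>\<not> \<eta>)"

definition falsity :: "form \<Rightarrow> real"
  where "falsity a = (INF s\<in>{s. K s \<^bold>\<rightarrow> a \<in> T}. real_of_ui s)"

lemma in_T: "\<turnstile> a \<Longrightarrow> a \<in> T"
  by (rule deductiveD(1)[OF ded])

lemma T_mp: "a \<^bold>\<rightarrow> b \<in> T \<Longrightarrow> a \<in> T \<Longrightarrow> b \<in> T"
  by (rule deductiveD(2)[OF ded])

lemma T_mp_thm: "\<turnstile> a \<^bold>\<rightarrow> b \<Longrightarrow> a \<in> T \<Longrightarrow> b \<in> T"
  using in_T T_mp by blast

lemma T_trans: "a \<^bold>\<rightarrow> b \<in> T \<Longrightarrow> b \<^bold>\<rightarrow> c \<in> T \<Longrightarrow> a \<^bold>\<rightarrow> c \<in> T"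
  using L2 T_mp T_mp_thm by blast

lemma T_mono: "a' \<^bold>\<rightarrow> a \<in> T \<Longrightarrow> b \<^bold>\<rightarrow> b' \<in> T \<Longrightarrow> (a \<^bold>\<rightarrow> b) \<^bold>\<rightarrow> (a' \<^bold>\<rightarrow> b') \<in> T"
proof -
  assume a: "a' \<^bold>\<rightarrow> a \<in> T" and b: "b \<^bold>\<rightarrow> b' \<in> T"
  have "(a \<^bold>\<rightarrow> b) \<^bold>\<rightarrow> (a' \<^bold>\<rightarrow> b) \<in> T"
    using a L2 T_mp_thm by blast
  moreover have "(a' \<^bold>\<rightarrow> b) \<^bold>\<rightarrow> (a' \<^bold>\<rightarrow> b') \<in> T"
    using T_mp_thm[OF MP[OF L2 imp_swap[THEN MP]]] b L2 imp_exchange T_mp_thm by blast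
  ultimately show ?thesis by (rule T_trans)
qed

text \<open>An implication holding only modulo T has no necessitation rule to lift it. Instead (R4)
  puts it under degree 1, antitonicity lowers the degree to r, and (R1) distributes.\<close>

lemma Nabla_mono: "a \<^bold>\<rightarrow> b \<in> T \<Longrightarrow> Nabla r a \<^bold>\<rightarrow> Nabla r b \<in> T"
proof -
  assume "a \<^bold>\<rightarrow> b \<in> T"
  moreover have "\<turnstile> (a \<^bold>\<rightarrow> b) \<^bold>\<rightarrow> Nabla 1 (a \<^bold>\<rightarrow> b)"
    using R4 derivable_iff by blast
  moreover have "\<turnstile> Nabla 1 (a \<^bold>\<rightarrow> b) \<^bold>\<rightarrow> Nabla r (a \<^bold>\<rightarrow> b)"
    by (rule Nabla_antimono) (simp add: one_unit_interval.rep_eq real_of_ui_le_1)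
  moreover have "\<turnstile> Nabla r (a \<^bold>\<rightarrow> b) \<^bold>\<rightarrow> (Nabla r a \<^bold>\<rightarrow> Nabla r b)"
    using R1 derivable_iff by blast
  ultimately show ?thesis
    using T_mp_thm by blast
qed

lemma K_1: "\<turnstile> K 1 \<^bold>\<rightarrow> a"
  using R4 derivable_iff ex_falso[OF \<eta>] imp_trans by blast

text \<open>Archimedean argument: by (R2), having \<open>K s\<close> in T lets the degree of a
  constant in T grow by s. If s > 0, finitely many such steps reach \<open>K 1\<close>, which
  implies the falsum. Hence T keeps distinct constants apart.\<close>

lemma K_eq_0:
  assumes "K s \<in> T"
  shows "real_of_ui s = 0"
proof (rule ccontr)
  assume "real_of_ui s \<noteq> 0"
  then have s: "0 < real_of_ui s"
    using real_of_ui_ge_0[of s] by simp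
  have "K r \<in> T" if "real_of_ui r \<le> real n * real_of_ui s" for n r
    using that
  proof (induction n arbitrary: r)
    case 0
    then show ?case
      using real_of_ui_ge_0[of r] by (auto intro: in_T Nabla_0)
  next
    case (Suc n)
    have "K (trunc_diff r s) \<in> T"
      using Suc.prems s by (intro Suc.IH) (auto simp: trunc_diff.rep_eq algebra_simps)
    then have "K s \<^bold>\<rightarrow> K r \<in> T"
      using R2 derivable_iff T_mp_thm by blast
    then show ?case
      using assms T_mp by blast
  qed
  moreover obtain n :: nat where "1 < real n * real_of_ui s"
    using reals_Archimedean3[OF s] by blast
  ultimately have "K 1 \<in> T"
    by (metis one_unit_interval.rep_eq less_imp_le)
  then show False
    using K_1 T_mp_thm proper by blast
qed

lemma K_imp: "K p \<^bold>\<rightarrow> K q \<in> T \<Longrightarrow> real_of_ui q \<le> real_of_ui p"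
proof -
  assume "K p \<^bold>\<rightarrow> K q \<in> T"
  then have "K (trunc_diff q p) \<in> T"
    using R2 derivable_iff T_mp_thm by blast
  from K_eq_0[OF this] show ?thesis
    by (simp add: trunc_diff.rep_eq)
qed

lemma falsity_set: "bdd_below (real_of_ui ` {s. K s \<^bold>\<rightarrow> a \<in> T})" "1 \<in> {s. K s \<^bold>\<rightarrow> a \<in> T}"
  using in_T K_1 by (auto intro: bdd_belowI2[of _ 0] real_of_ui_ge_0)

lemma falsity_le: "K s \<^bold>\<rightarrow> a \<in> T \<Longrightarrow> falsity a \<le> real_of_ui s"
  unfolding falsity_def using falsity_set(1) by (rule cINF_lower) simp

lemma falsity_ge:
  assumes "a \<^bold>\<rightarrow> K s \<in> T"
  shows "real_of_ui s \<le> falsity a"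
  unfolding falsity_def
proof (rule cINF_greatest)
  show "{s. K s \<^bold>\<rightarrow> a \<in> T} \<noteq> {}" using falsity_set(2) by blast
  show "real_of_ui s \<le> real_of_ui t" if "t \<in> {s. K s \<^bold>\<rightarrow> a \<in> T}" for t
    using that assms T_trans K_imp by blast
qed

lemma falsity_bounds: "0 \<le> falsity a" "falsity a \<le> 1"
proof -
  have "a \<^bold>\<rightarrow> K (ui_of_real 0) \<in> T"
    by (intro in_T MP[OF Nabla_0 L1]) (simp add: ui_of_real_inverse)
  then show "0 \<le> falsity a"
    using falsity_ge by (fastforce simp: ui_of_real_inverse)
  show "falsity a \<le> 1"
    using falsity_le[OF in_T[OF K_1]] by (simp add: one_unit_interval.rep_eq)
qed

lemma falsity_upper:
  assumes "0 < \<epsilon>"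
  obtains s where "K s \<^bold>\<rightarrow> a \<in> T" "real_of_ui s < falsity a + \<epsilon>"
proof -
  have "falsity a < falsity a + \<epsilon>" using assms by simp
  then obtain s where "s \<in> {s. K s \<^bold>\<rightarrow> a \<in> T}" "real_of_ui s < falsity a + \<epsilon>"
    unfolding falsity_def using falsity_set cINF_less_iff by (metis (no_types, lifting) empty_iff)
  with that show thesis by blast
qed

text \<open>This is where linearity enters: a degree strictly below the infimum gives a constant
  that does not imply a, so a implies it. Truncation keeps the degree in the unit interval, and at
  degree 0 the constant is itself a theorem.\<close>

lemma falsity_lower:
  assumes "0 < \<epsilon>"
  obtains s where "a \<^bold>\<rightarrow> K s \<in> T" "falsity a - \<epsilon> \<le> real_of_ui s"
proof -
  define s where "s = ui_of_real (max 0 (falsity a - \<epsilon>))"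
  have s: "real_of_ui s = max 0 (falsity a - \<epsilon>)"
    unfolding s_def using assms falsity_bounds[of a] by (intro ui_of_real_inverse) auto
  have "a \<^bold>\<rightarrow> K s \<in> T"
  proof (cases "real_of_ui s = 0")
    case True
    then show ?thesis by (intro in_T MP[OF Nabla_0 L1])
  next
    case False
    then have "real_of_ui s < falsity a" using assms s by auto
    then have "K s \<^bold>\<rightarrow> a \<notin> T" using falsity_le by fastforce
    then show ?thesis using linear by blast
  qed
  with that s show thesis by force
qed

text \<open>Constants approximate a and b from opposite sides, as implication is antitone on the
  left. (R2) evaluates the implication between the constants, and each side costs half of
  \<epsilon>.\<close>

lemma falsity_Imp: "falsity (a \<^bold>\<rightarrow> b) = max 0 (falsity b - falsity a)"
proof (rule antisym)
  show "falsity (a \<^bold>\<rightarrow> b) \<le> max 0 (falsity b - falsity a)"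
  proof (rule field_le_epsilon)
    fix \<epsilon> :: real assume "0 < \<epsilon>"
    then have half: "0 < \<epsilon> / 2" by simp
    obtain p where p: "a \<^bold>\<rightarrow> K p \<in> T" "falsity a - \<epsilon> / 2 \<le> real_of_ui p"
      using falsity_lower[OF half] .
    obtain q where q: "K q \<^bold>\<rightarrow> b \<in> T" "real_of_ui q < falsity b + \<epsilon> / 2"
      using falsity_upper[OF half] .
    have "K (trunc_diff q p) \<^bold>\<rightarrow> (K p \<^bold>\<rightarrow> K q) \<in> T"
      using R2 derivable_iff in_T by blast
    from falsity_le[OF T_trans[OF this T_mono[OF p(1) q(1)]]] p q \<open>0 < \<epsilon>\<close>
    show "falsity (a \<^bold>\<rightarrow> b) \<le> max 0 (falsity b - falsity a) + \<epsilon>"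
      by (auto simp: trunc_diff.rep_eq)
  qed
  show "max 0 (falsity b - falsity a) \<le> falsity (a \<^bold>\<rightarrow> b)"
  proof (rule field_le_epsilon)
    fix \<epsilon> :: real assume "0 < \<epsilon>"
    then have half: "0 < \<epsilon> / 2" by simp
    obtain p where p: "K p \<^bold>\<rightarrow> a \<in> T" "real_of_ui p < falsity a + \<epsilon> / 2"
      using falsity_upper[OF half] .
    obtain q where q: "b \<^bold>\<rightarrow> K q \<in> T" "falsity b - \<epsilon> / 2 \<le> real_of_ui q"
      using falsity_lower[OF half] .
    have "(K p \<^bold>\<rightarrow> K q) \<^bold>\<rightarrow> K (trunc_diff q p) \<in> T"
      using R2 derivable_iff in_T by blast
    from falsity_ge[OF T_trans[OF T_mono[OF p(1) q(1)] this]] p q \<open>0 < \<epsilon>\<close>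
    show "max 0 (falsity b - falsity a) \<le> falsity (a \<^bold>\<rightarrow> b) + \<epsilon>"
      by (auto simp: trunc_diff.rep_eq)
  qed
qed

lemma falsity_cong: "\<turnstile> a \<^bold>\<leftrightarrow> b \<Longrightarrow> falsity a = falsity b"
  unfolding falsity_def derivable_iff
  by (intro arg_cong[where f = Inf] arg_cong[where f = "image real_of_ui"]) (blast intro: T_trans in_T)

lemma falsity_falsum: "falsity (\<^bold>\<not> \<eta>) = 1"
proof -
  have "\<^bold>\<not> \<eta> \<^bold>\<rightarrow> K 1 \<in> T"
    using ex_falso[OF \<eta>] in_T by blast
  from falsity_ge[OF this] falsity_bounds(2) show ?thesis
    by (simp add: one_unit_interval.rep_eq antisym)
qed

text \<open>Negation is implication into the falsum, whose falsity is 1, so the clause for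
  implication applies.\<close>

lemma falsity_Neg: "falsity (\<^bold>\<not> a) = 1 - falsity a"
proof -
  have "\<turnstile> (a \<^bold>\<rightarrow> \<^bold>\<not> \<eta>) \<^bold>\<rightarrow> \<^bold>\<not> a"
  proof -
    have "\<turnstile> (a \<^bold>\<rightarrow> \<^bold>\<not> \<eta>) \<^bold>\<rightarrow> (\<^bold>\<not> \<^bold>\<not> \<eta> \<^bold>\<rightarrow> \<^bold>\<not> a)" by (rule contrapos_imp)
    then show ?thesis
      using \<eta> by (meson MP dn_intro imp_exchange)
  qed
  moreover have "\<turnstile> \<^bold>\<not> a \<^bold>\<rightarrow> (a \<^bold>\<rightarrow> \<^bold>\<not> \<eta>)"
    by (rule imp_trans[OF L1 L4])
  ultimately have "falsity (\<^bold>\<not> a) = falsity (a \<^bold>\<rightarrow> \<^bold>\<not> \<eta>)"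
    by (intro falsity_cong) (simp add: derivable_iff)
  then show ?thesis
    using falsity_bounds[of a] by (simp add: falsity_Imp falsity_falsum)
qed

text \<open>Again a is replaced by nearby constants; (R3) makes nabla of a constant a constant whose
  degree is the product.\<close>

lemma falsity_Nabla: "falsity (Nabla r a) = real_of_ui r * falsity a"
proof (rule antisym)
  have small: "real_of_ui r * \<epsilon> \<le> \<epsilon>" if "0 < \<epsilon>" for \<epsilon>
    using that mult_right_mono[OF real_of_ui_le_1, of \<epsilon> r] by simp
  show "falsity (Nabla r a) \<le> real_of_ui r * falsity a"
  proof (rule field_le_epsilon)
    fix \<epsilon> :: real assume \<epsilon>: "0 < \<epsilon>"
    then obtain s where s: "K s \<^bold>\<rightarrow> a \<in> T" "real_of_ui s < falsity a + \<epsilon>"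
      using falsity_upper by blast
    have "K (r * s) \<^bold>\<rightarrow> Nabla r (K s) \<in> T"
      using R3 derivable_iff in_T by blast
    from falsity_le[OF T_trans[OF this Nabla_mono[OF s(1)]]]
    have "falsity (Nabla r a) \<le> real_of_ui r * real_of_ui s"
      by (simp add: times_unit_interval.rep_eq)
    also have "\<dots> \<le> real_of_ui r * (falsity a + \<epsilon>)"
      using s real_of_ui_ge_0 by (intro mult_left_mono) auto
    finally show "falsity (Nabla r a) \<le> real_of_ui r * falsity a + \<epsilon>"
      using small[OF \<epsilon>] by (simp add: distrib_left)
  qed
  show "real_of_ui r * falsity a \<le> falsity (Nabla r a)"
  proof (rule field_le_epsilon)
    fix \<epsilon> :: real assume \<epsilon>: "0 < \<epsilon>"
    then obtain s where s: "a \<^bold>\<rightarrow> K s \<in> T" "falsity a - \<epsilon> \<le> real_of_ui s"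
      using falsity_lower by blast
    have "Nabla r (K s) \<^bold>\<rightarrow> K (r * s) \<in> T"
      using R3 derivable_iff in_T by blast
    from falsity_ge[OF T_trans[OF Nabla_mono[OF s(1)] this]]
    have "real_of_ui r * real_of_ui s \<le> falsity (Nabla r a)"
      by (simp add: times_unit_interval.rep_eq)
    moreover have "real_of_ui r * (falsity a - \<epsilon>) \<le> real_of_ui r * real_of_ui s"
      using s real_of_ui_ge_0 by (intro mult_left_mono) auto
    ultimately show "real_of_ui r * falsity a \<le> falsity (Nabla r a) + \<epsilon>"
      using small[OF \<epsilon>] by (simp add: right_diff_distrib)
  qed
qed

lemma evaluation_falsity: "evaluation (\<lambda>a. 1 - falsity a)"
  unfolding evaluation_def using falsity_bounds
  by (auto simp: falsity_Neg falsity_Imp falsity_Nabla)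

end

section \<open>Soundness and approximate completeness\<close>

lemma soundness:
  assumes "\<turnstile> a" "x \<in> points"
  shows "term_fun a x = 1"
  using assms(1)
proof induction
  case (MP a b)
  then show ?case using term_fun_bounds[OF assms(2), of b] by auto
next
  case (R1 r a b)
  \<comment> \<open>In terms of one minus the value, nabla is scaling by r, and scaling by a
    nonnegative number commutes with truncation at 0. The case (R2) uses the same fact with 1 - A as
    the factor.\<close>
  have "real_of_ui r * (1 - min 1 (1 - A + B)) = max 0 (real_of_ui r * (1 - B) - real_of_ui r * (1 - A))" for A B
  proof -
    have "1 - min 1 (1 - A + B) = max 0 (A - B)" by simp
    then show ?thesis
      using real_of_ui_ge_0[of r] by (simp add: max_mult_distrib_left right_diff_distrib)
  qed
  then show ?case by (simp add: Iff_def Conj_def)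
next
  case (R2 r q a)
  have "max 0 (real_of_ui r - real_of_ui q) * (1 - A) = max 0 (real_of_ui r * (1 - A) - real_of_ui q * (1 - A))" if "A \<le> 1" for A
    using that by (simp add: max_mult_distrib_right left_diff_distrib)
  with term_fun_bounds[OF assms(2), of a] show ?case by (simp add: Iff_def Conj_def trunc_diff.rep_eq)
next
  case (R3 r q a)
  then show ?case by (simp add: Iff_def Conj_def times_unit_interval.rep_eq)
next
  case (R4 a)
  then show ?case by (simp add: Iff_def Conj_def one_unit_interval.rep_eq)
qed (use term_fun_bounds[OF assms(2)] in \<open>auto simp: Or_def min_def\<close>)


lemma approximate_completeness:
  assumes \<eta>: "\<turnstile> \<eta>" and c: "\<And>x. x \<in> points \<Longrightarrow> c \<le> term_fun a x" and r: "real_of_ui r < c"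
  shows "\<turnstile> Delta r \<eta> \<^bold>\<rightarrow> a"
proof (rule ccontr)
  assume not: "\<not> \<turnstile> Delta r \<eta> \<^bold>\<rightarrow> a"
  \<comment> \<open>The constant \<open>?K ?s\<close> has value 1 - (1 - r) = r, like
    \<open>\<eta>\<^sub>r\<close>, but has the shape in which \<open>falsity\<close> is
    measured.\<close>
  let ?s = "trunc_diff 1 r"
  let ?K = "\<lambda>q. Nabla q (\<^bold>\<not> \<eta>)"
  have "\<turnstile> Delta r \<eta> \<^bold>\<rightarrow> (?K r \<^bold>\<rightarrow> ?K 1)"
    unfolding Delta_def by (rule imp_trans[OF L1 L4])
  then have "\<turnstile> Delta r \<eta> \<^bold>\<rightarrow> ?K ?s"
    using R2 derivable_iff imp_trans by blast
  then have "\<not> \<turnstile> ?K ?s \<^bold>\<rightarrow> a"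
    using not imp_trans by blast
  then obtain T where T: "deductive T" "?K ?s \<^bold>\<rightarrow> a \<notin> T" "\<And>a b. a \<^bold>\<rightarrow> b \<in> T \<or> b \<^bold>\<rightarrow> a \<in> T"
    using linear_extension by blast
  interpret linear_theory T \<eta>
  proof
    show "\<^bold>\<not> \<eta> \<notin> T"
      using T(2) ex_falso[OF \<eta>] deductiveD[OF T(1)] by blast
  qed (use T \<eta> in auto)
  \<comment> \<open>Linearity gives the converse implication, so the value of a modulo T is at most
    r; the point formed by the values of the variables forces it to be at least c.\<close>
  have "a \<^bold>\<rightarrow> ?K ?s \<in> T"
    using T(2,3) by blast
  then have "1 - falsity a \<le> real_of_ui r"
    using falsity_ge[of a ?s] real_of_ui_le_1[of r]
    by (simp add: trunc_diff.rep_eq one_unit_interval.rep_eq)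
  moreover have "c \<le> 1 - falsity a"
  proof -
    let ?x = "\<lambda>i. 1 - falsity (Var i)"
    have "?x \<in> points"
      using falsity_bounds by (auto simp: points_def)
    moreover have "1 - falsity a = term_fun a ?x"
      by (rule evaluation_unique[OF evaluation_falsity]) simp
    ultimately show ?thesis
      using c by simp
  qed
  ultimately show False
    using r by simp
qed


section \<open>Uniform convergence\<close>

text \<open>One of the two implications always has value 1, so the strong conjunction takes the
  value of the other.\<close>

lemma term_fun_Iff:
  assumes "x \<in> points"
  shows "term_fun (a \<^bold>\<leftrightarrow> b) x = 1 - \<bar>term_fun a x - term_fun b x\<bar>"
  using term_fun_bounds[OF assms, of a] term_fun_bounds[OF assms, of b]
  by (auto simp: Iff_def Conj_def min_def abs_if)

lemma term_fun_Delta_theorem: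
  assumes "\<turnstile> \<eta>" "x \<in> points"
  shows "term_fun (Delta r \<eta>) x = real_of_ui r"
  using soundness[OF assms] by (simp add: Delta_def)

lemma sound_Imp:
  assumes "\<turnstile> a \<^bold>\<rightarrow> b" "x \<in> points"
  shows "term_fun a x \<le> term_fun b x"
  using soundness[OF assms] by (simp add: min_def split: if_splits)

lemma Delta_mono_degree:
  assumes "r \<le> q"
  shows "\<turnstile> Delta r a \<^bold>\<rightarrow> Delta q a"
  unfolding Delta_def using assms
  by (intro contrapos Nabla_antimono) (simp add: less_eq_unit_interval.rep_eq)

section \<open>Compactness of the cube and Dini's argument\<close>

lemma continuous_term_fun: "continuous_on UNIV (term_fun a)"
proof (induction a)
  case (Var i)
  then show ?case by simp
qed (auto intro!: continuous_intros)

text \<open>Tychonoff: the function type carries the product topology.\<close>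

lemma compact_points: "compact points"
proof -
  have "compactin (product_topology (\<lambda>_. euclidean) UNIV) (Pi\<^sub>E UNIV (\<lambda>_::nat. {0..1::real}))"
    by (subst compactin_PiE) auto
  then show ?thesis
    by (simp add: points_def PiE_UNIV_domain euclidean_product_topology)
qed

text \<open>The open sets where \<open>f n\<close> is below \<epsilon> cover S. A finite subcover
  suffices, and by monotonicity its largest index works at every point.\<close>

lemma compact_decseq_uniform:
  fixes f :: "nat \<Rightarrow> 'a::topological_space \<Rightarrow> real"
  assumes "compact S" and cont: "\<And>n. continuous_on UNIV (f n)"
    and dec: "\<And>m n x. x \<in> S \<Longrightarrow> m \<le> n \<Longrightarrow> f n x \<le> f m x"
    and small: "\<And>x. x \<in> S \<Longrightarrow> \<exists>n. f n x < \<epsilon>"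
  shows "\<exists>N. \<forall>n\<ge>N. \<forall>x\<in>S. f n x < \<epsilon>"
proof -
  have "open {x. f n x < \<epsilon>}" for n
    using cont by (intro open_Collect_less continuous_on_const) auto
  moreover have "S \<subseteq> (\<Union>n\<in>UNIV. {x. f n x < \<epsilon>})"
    using small by blast
  ultimately obtain D where D: "finite D" "S \<subseteq> (\<Union>n\<in>D. {x. f n x < \<epsilon>})"
    using compactE_image[OF \<open>compact S\<close>, of UNIV "\<lambda>n. {x. f n x < \<epsilon>}"] by auto
  \<comment> \<open>Inserting 0 keeps the maximum meaningful when the subcover is empty.\<close>
  have "f n x < \<epsilon>" if n: "Max (insert 0 D) \<le> n" and x: "x \<in> S" for n x
  proof -
    obtain m where m: "m \<in> D" "f m x < \<epsilon>"
      using D(2) x by blast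
    then have "m \<le> n"
      using n D(1) by simp
    then show ?thesis
      using dec[OF x] m(2) by fastforce
  qed
  then show ?thesis by blast
qed

text \<open>Soundness turns the order of \<open>RL\<close> into the pointwise order. The Chang
  distance becomes the absolute difference, dominated by a sequence that Dini's argument makes
  uniformly small.\<close>

lemma uniform_limit_of_decseq_bound:
  fixes \<phi>s \<psi>s :: "nat \<Rightarrow> form"
  assumes dec: "decseq (\<lambda>n. RL_class (\<psi>s n))"
    and inf: "\<And>x. x \<in> points \<Longrightarrow> (INF n. term_fun (\<psi>s n) x) = 0"
    and bound: "\<And>n. chang_dist (RL_class (\<phi>s n)) (RL_class \<phi>) \<le> RL_class (\<psi>s n)"
  shows "uniform_limit points (\<lambda>n. term_fun (\<phi>s n)) (term_fun \<phi>) sequentially"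
proof (rule uniform_limitI)
  fix \<epsilon> :: real assume \<epsilon>: "0 < \<epsilon>"
  have dec': "term_fun (\<psi>s n) x \<le> term_fun (\<psi>s m) x" if "x \<in> points" "m \<le> n" for m n x
    using decseqD[OF dec that(2)] that(1) by (intro sound_Imp) (simp_all add: less_eq_RL.abs_eq)
  have small: "\<exists>n. term_fun (\<psi>s n) x < \<epsilon>" if "x \<in> points" for x
  proof -
    have "bdd_below (range (\<lambda>n. term_fun (\<psi>s n) x))"
      using term_fun_bounds[OF that] by (intro bdd_belowI2[of _ 0]) auto
    then show ?thesis
      using cINF_less_iff[of UNIV "\<lambda>n. term_fun (\<psi>s n) x" \<epsilon>] inf[OF that] \<epsilon> by auto
  qed
  obtain N where N: "\<And>n x. N \<le> n \<Longrightarrow> x \<in> points \<Longrightarrow> term_fun (\<psi>s n) x < \<epsilon>"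
    using compact_decseq_uniform[OF compact_points continuous_term_fun dec' small] by blast
  have "\<bar>term_fun (\<phi>s n) x - term_fun \<phi> x\<bar> \<le> term_fun (\<psi>s n) x" if "x \<in> points" for n x
    using bound[of n] sound_Imp[OF _ that, of "\<^bold>\<not> (\<phi>s n \<^bold>\<leftrightarrow> \<phi>)" "\<psi>s n"] term_fun_Iff[OF that]
    by (simp add: less_eq_RL.abs_eq chang_dist.abs_eq)
  then show "\<forall>\<^sub>F n in sequentially. \<forall>x\<in>points. dist (term_fun (\<phi>s n) x) (term_fun \<phi> x) < \<epsilon>"
    unfolding eventually_sequentially dist_real_def using N le_less_trans by blast
qed

text \<open>The bounds are the negations of \<open>\<eta>\<^sub>r\<close> at r = \<open>r n\<close>,
  constants of value 1 - \<open>r n\<close>; contraposing the hypothesis bounds the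
  distance.\<close>

lemma decseq_bound_of_Delta:
  fixes \<phi>s :: "nat \<Rightarrow> form"
  assumes \<eta>: "\<turnstile> \<eta>" and r: "incseq r" "(SUP n. real_of_ui (r n)) = 1"
    and \<phi>s: "\<And>n. \<turnstile> Delta (r n) \<eta> \<^bold>\<rightarrow> (\<phi> \<^bold>\<leftrightarrow> \<phi>s n)"
  shows "decseq (\<lambda>n. RL_class (\<^bold>\<not> Delta (r n) \<eta>))"
    and "x \<in> points \<Longrightarrow> (INF n. term_fun (\<^bold>\<not> Delta (r n) \<eta>) x) = 0"
    and "chang_dist (RL_class (\<phi>s n)) (RL_class \<phi>) \<le> RL_class (\<^bold>\<not> Delta (r n) \<eta>)"
proof -
  show "decseq (\<lambda>n. RL_class (\<^bold>\<not> Delta (r n) \<eta>))"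
    using incseqD[OF r(1)] by (auto simp: decseq_def less_eq_RL.abs_eq intro!: contrapos Delta_mono_degree)
  show "(INF n. term_fun (\<^bold>\<not> Delta (r n) \<eta>) x) = 0" if x: "x \<in> points"
  proof -
    have bdd: "bdd_above (range (\<lambda>n. real_of_ui (r n)))"
      using real_of_ui_le_1 by (intro bdd_aboveI2[of _ _ 1])
    have eq: "term_fun (\<^bold>\<not> Delta (r n) \<eta>) x = 1 - real_of_ui (r n)" for n
      using term_fun_Delta_theorem[OF \<eta> x] by simp
    show ?thesis
      unfolding eq
    proof (rule cInf_eq_non_empty)
      show "0 \<le> y" if "y \<in> range (\<lambda>n. 1 - real_of_ui (r n))" for y
        using that real_of_ui_le_1 by auto
      show "y \<le> 0" if y: "\<And>z. z \<in> range (\<lambda>n. 1 - real_of_ui (r n)) \<Longrightarrow> y \<le> z" for y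
      proof -
        have "real_of_ui (r n) \<le> 1 - y" for n
          using y[of "1 - real_of_ui (r n)"] by simp
        then have "(SUP n. real_of_ui (r n)) \<le> 1 - y"
          by (intro cSUP_least) auto
        then show ?thesis using r(2) by simp
      qed
    qed simp
  qed
  have "\<turnstile> (\<phi> \<^bold>\<leftrightarrow> \<phi>s n) \<^bold>\<rightarrow> (\<phi>s n \<^bold>\<leftrightarrow> \<phi>)"
    unfolding Iff_def by (rule conj_commute)
  then show "chang_dist (RL_class (\<phi>s n)) (RL_class \<phi>) \<le> RL_class (\<^bold>\<not> Delta (r n) \<eta>)"
    using \<phi>s imp_trans by (auto simp: chang_dist.abs_eq less_eq_RL.abs_eq intro!: contrapos)
qed

text \<open>Diagonal choice: at index n take the best degree, among finitely many candidates, that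
  is already good from n onwards.\<close>

lemma increasing_degrees:
  fixes P :: "unit_interval \<Rightarrow> nat \<Rightarrow> bool"
  assumes zero: "\<And>r n. real_of_ui r = 0 \<Longrightarrow> P r n"
    and ev: "\<And>r. r < 1 \<Longrightarrow> \<exists>k. \<forall>n\<ge>k. P r n"
  obtains r where "incseq r" "(SUP n. real_of_ui (r n)) = 1" "\<And>n. P (r n) n"
proof -
  \<comment> \<open>The candidates start at 0, where P always holds, stay below 1 so that
    \<open>ev\<close> applies, and tend to 1.\<close>
  define q where "q j = ui_of_real (real j / (real j + 1))" for j :: nat
  have q: "real_of_ui (q j) = real j / (real j + 1)" for j
    unfolding q_def by (rule ui_of_real_inverse) auto
  \<comment> \<open>Demanding P at all later indices, not just at n, makes the sets grow with n and
    hence their maxima increase.\<close>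
  define A where "A n = {q j |j. j \<le> n \<and> (\<forall>m\<ge>n. P (q j) m)}" for n
  define r where "r n = Max (A n)" for n
  have fin: "finite (A n)" for n
    unfolding A_def by simp
  have "q 0 \<in> A n" for n
    unfolding A_def using zero[of "q 0"] q[of 0] by auto
  then have ne: "A n \<noteq> {}" for n by blast
  show thesis
  proof
    show "incseq r"
    proof (rule incseq_SucI)
      fix n
      have "A n \<subseteq> A (Suc n)"
        unfolding A_def by fastforce
      then show "r n \<le> r (Suc n)"
        unfolding r_def using ne fin by (intro Max_mono)
    qed
    show "P (r n) n" for n
      using Max_in[OF fin ne, of n] unfolding r_def A_def by auto
    \<comment> \<open>At index \<open>max j k\<close> the candidate \<open>q j\<close> is both
      listed and permanently good, so the maximum has reached it.\<close>
    have "q j \<le> r (max j k)" if "\<forall>n\<ge>k. P (q j) n" for j k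
      unfolding r_def using that by (intro Max_ge fin) (auto simp: A_def)
    then have ex: "\<exists>n. real_of_ui (q j) \<le> real_of_ui (r n)" for j
      using ev[of "q j"] q by (fastforce simp: less_unit_interval.rep_eq less_eq_unit_interval.rep_eq one_unit_interval.rep_eq)
    show "(SUP n. real_of_ui (r n)) = 1"
    proof (rule cSup_eq_non_empty)
      show "y \<le> 1" if "y \<in> range (\<lambda>n. real_of_ui (r n))" for y
        using that real_of_ui_le_1 by auto
      show "1 \<le> y" if y: "\<And>z. z \<in> range (\<lambda>n. real_of_ui (r n)) \<Longrightarrow> z \<le> y" for y
      proof (rule LIMSEQ_le_const2)
        show "(\<lambda>j. real j / (real j + 1)) \<longlonglongrightarrow> 1"
          using LIMSEQ_n_over_Suc_n by (simp add: add.commute)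
        show "\<exists>N. \<forall>j\<ge>N. real j / (real j + 1) \<le> y"
          using ex q y by (metis order_trans rangeI)
      qed
    qed simp
  qed
qed

theorem theorem2p8:
  fixes \<phi>s :: "nat \<Rightarrow> form" and \<phi> \<eta> :: form
  assumes "\<turnstile> \<eta>"
  defines "i \<equiv> uniform_limit points (\<lambda>n. term_fun (\<phi>s n)) (term_fun \<phi>) sequentially"
    and "ii \<equiv> \<forall>r::unit_interval. r < 1 \<longrightarrow>
      (\<exists>k. \<forall>n\<ge>k. \<turnstile> Delta r \<eta> \<^bold>\<rightarrow> (\<phi> \<^bold>\<leftrightarrow> \<phi>s n))"
    and "iii \<equiv> \<exists>\<psi>s :: nat \<Rightarrow> form.
      decseq (\<lambda>n. RL_class (\<psi>s n)) \<and>
      (\<forall>x\<in>points. (INF n. term_fun (\<psi>s n) x) = 0) \<and>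
      (\<forall>n. chang_dist (RL_class (\<phi>s n)) (RL_class \<phi>) \<le> RL_class (\<psi>s n))"
    and "iv \<equiv> \<exists>r :: nat \<Rightarrow> unit_interval.
      incseq r \<and> (SUP n. real_of_ui (r n)) = 1 \<and>
      (\<forall>n. \<turnstile> Delta (r n) \<eta> \<^bold>\<rightarrow> (\<phi> \<^bold>\<leftrightarrow> \<phi>s n))"
  shows "(i \<longleftrightarrow> ii) \<and> (i \<longleftrightarrow> iii) \<and> (i \<longleftrightarrow> iv)"
proof -
  note \<eta> = \<open>\<turnstile> \<eta>\<close>
  have "i \<Longrightarrow> ii"
    unfolding ii_def
  proof (intro allI impI)
    fix r :: unit_interval assume i and "r < 1"
    then have r: "real_of_ui r < 1"
      by (simp add: less_unit_interval.rep_eq one_unit_interval.rep_eq)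
    \<comment> \<open>The midpoint of r and 1 splits the slack: 1 - c is the tolerance for uniform
      convergence, and r < c is the strict gap that approximate completeness requires.\<close>
    define c where "c = (1 + real_of_ui r) / 2"
    have c: "real_of_ui r < c" "c < 1"
      using r by (auto simp: c_def)
    obtain k where k: "\<And>n x. k \<le> n \<Longrightarrow> x \<in> points \<Longrightarrow> \<bar>term_fun (\<phi>s n) x - term_fun \<phi> x\<bar> < 1 - c"
      using uniform_limitD[OF \<open>i\<close>[unfolded i_def], of "1 - c"] c(2)
      by (auto simp: eventually_sequentially dist_real_def)
    have "\<turnstile> Delta r \<eta> \<^bold>\<rightarrow> (\<phi> \<^bold>\<leftrightarrow> \<phi>s n)" if "k \<le> n" for n
    proof (rule approximate_completeness[OF \<eta> _ c(1)])
      show "c \<le> term_fun (\<phi> \<^bold>\<leftrightarrow> \<phi>s n) x" if "x \<in> points" for x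
        using k[OF \<open>k \<le> n\<close> that] by (simp add: term_fun_Iff[OF that] abs_minus_commute)
    qed
    then show "\<exists>k. \<forall>n\<ge>k. \<turnstile> Delta r \<eta> \<^bold>\<rightarrow> (\<phi> \<^bold>\<leftrightarrow> \<phi>s n)" by blast
  qed
  moreover have "ii \<Longrightarrow> iv"
  proof -
    assume ii
    \<comment> \<open>At degree 0 the constant is a falsum and implies everything, which provides
      the starting candidate of \<open>increasing_degrees\<close>.\<close>
    have "\<turnstile> Delta r \<eta> \<^bold>\<rightarrow> a" if "real_of_ui r = 0" for r a
      using Nabla_0[OF that] unfolding Delta_def by (meson L1 L4 MP dn_intro imp_trans)
    then obtain r where "incseq r" "(SUP n. real_of_ui (r n)) = 1"
      "\<And>n. \<turnstile> Delta (r n) \<eta> \<^bold>\<rightarrow> (\<phi> \<^bold>\<leftrightarrow> \<phi>s n)"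
      using increasing_degrees[of "\<lambda>r n. \<turnstile> Delta r \<eta> \<^bold>\<rightarrow> (\<phi> \<^bold>\<leftrightarrow> \<phi>s n)"] \<open>ii\<close>
      unfolding ii_def by metis
    then show iv
      unfolding iv_def by blast
  qed
  moreover have "iv \<Longrightarrow> iii"
    unfolding iv_def iii_def using decseq_bound_of_Delta[OF \<eta>] by metis
  moreover have "iii \<Longrightarrow> i"
    unfolding iii_def i_def using uniform_limit_of_decseq_bound by metis
  ultimately show ?thesis by blast
qed

end
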